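(* Let $K$ be a compact metric space. Suppose that the group $\mathrm{Iso}(\mathrm{Lip}(K),\|\cdot\|_s)$ is canonical. Then every 2-local isometry $\Delta:(\mathrm{Lip}(K),\|\cdot\|_s)\to(\mathrm{Lip}(K),\|\cdot\|_s)$ is a surjective isometry.
   Context: For a metric space $K$, $\mathrm{Lip}(K)$ is the space of all bounded Lipschitz functions $f:K\to\mathbb{C}$, $L(f)=\sup\{|f(x)-f(y)|/d(x,y): x,y\in K,\ x\ne y\}$, and $\|f\|_s=L(f)+\|f\|_\infty$, a complete norm. For a Banach space $X$, $\mathrm{Iso}(X)$ denotes the set of all surjective linear isometries from $X$ onto itself. An element $T$ of $\mathrm{Iso}(\mathrm{Lip}(K),\|\cdot\|_s)$ is canonical if there exist $\tau\in\mathbb{C}$ with $|\tau|=1$ and a surjective isometry $\varphi:K\to K$ with $T(f)(s)=\tau f(\varphi(s))$ for all $f\in\mathrm{Lip}(K)$, $s\in K$; $\mathrm{Iso}(\mathrm{Lip}(K),\|\cdot\|_s)$ is canonical if every one of its elements is canonical. A (not necessarily linear nor continuous) mapping $\Delta:X\to X$ is a 2-local isometry if for each $x,y\in X$ there exists $T_{x,y}\in\mathrm{Iso}(X)$, depending on $x$ and $y$, with $\Delta(x)=T_{x,y}(x)$ and $\Delta(y)=T_{x,y}(y)$. *)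

theory Defs
  imports "HOL-Analysis.Analysis"
begin

text \<open>
  A function on \<open>K\<close> is represented by the total function that is \<open>0\<close> outside \<open>K\<close>. Every function
  on \<open>K\<close> then has exactly one representative, and the vector space operations are the pointwise ones.
\<close>

definition Lip :: "'a::metric_space set \<Rightarrow> ('a \<Rightarrow> complex) set" where
  "Lip K = {f. (\<forall>x. x \<notin> K \<longrightarrow> f x = 0) \<and> bounded (f ` K) \<and> (\<exists>C. C-lipschitz_on K f)}"

text \<open>
  The element \<open>0\<close> is inserted below because \<open>Sup {}\<close> is unspecified on the reals; it matters only
  when \<open>K\<close> has at most one point (for the Lipschitz constant) or none (for the uniform norm).
\<close>

definition lip_const :: "'a::metric_space set \<Rightarrow> ('a \<Rightarrow> complex) \<Rightarrow> real" where
  "lip_const K f = Sup (insert 0 {norm (f x - f y) / dist x y | x y. x \<in> K \<and> y \<in> K \<and> x \<noteq> y})"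

definition unif_norm :: "'a set \<Rightarrow> ('a \<Rightarrow> complex) \<Rightarrow> real" where
  "unif_norm K f = Sup (insert 0 {norm (f x) | x. x \<in> K})"

definition lip_snorm :: "'a::metric_space set \<Rightarrow> ('a \<Rightarrow> complex) \<Rightarrow> real" where
  "lip_snorm K f = lip_const K f + unif_norm K f"

text \<open>
  In the following definitions \<open>X\<close> is a complex vector space of functions and \<open>N\<close> a norm on \<open>X\<close>.
  The values of a map outside \<open>X\<close> are irrelevant.
\<close>

definition surjective_isometry ::
    "('a \<Rightarrow> complex) set \<Rightarrow> (('a \<Rightarrow> complex) \<Rightarrow> real) \<Rightarrow> (('a \<Rightarrow> complex) \<Rightarrow> ('a \<Rightarrow> complex)) \<Rightarrow> bool"
  where "surjective_isometry X N T \<longleftrightarrow>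
    T ` X = X \<and> (\<forall>f\<in>X. \<forall>g\<in>X. N (\<lambda>x. T f x - T g x) = N (\<lambda>x. f x - g x))"

definition complex_linear_on ::
    "('a \<Rightarrow> complex) set \<Rightarrow> (('a \<Rightarrow> complex) \<Rightarrow> ('a \<Rightarrow> complex)) \<Rightarrow> bool"
  where "complex_linear_on X T \<longleftrightarrow>
    (\<forall>f\<in>X. \<forall>g\<in>X. T (\<lambda>x. f x + g x) = (\<lambda>x. T f x + T g x)) \<and>
    (\<forall>c. \<forall>f\<in>X. T (\<lambda>x. c * f x) = (\<lambda>x. c * T f x))"

definition Iso ::
    "('a \<Rightarrow> complex) set \<Rightarrow> (('a \<Rightarrow> complex) \<Rightarrow> real) \<Rightarrow> (('a \<Rightarrow> complex) \<Rightarrow> ('a \<Rightarrow> complex)) set"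
  where "Iso X N = {T. complex_linear_on X T \<and> surjective_isometry X N T}"

definition two_local_isometry ::
    "('a \<Rightarrow> complex) set \<Rightarrow> (('a \<Rightarrow> complex) \<Rightarrow> real) \<Rightarrow> (('a \<Rightarrow> complex) \<Rightarrow> ('a \<Rightarrow> complex)) \<Rightarrow> bool"
  where "two_local_isometry X N \<Delta> \<longleftrightarrow>
    \<Delta> \<in> X \<rightarrow> X \<and> (\<forall>f\<in>X. \<forall>g\<in>X. \<exists>T\<in>Iso X N. \<Delta> f = T f \<and> \<Delta> g = T g)"

definition canonical_map ::
    "'a::metric_space set \<Rightarrow> (('a \<Rightarrow> complex) \<Rightarrow> ('a \<Rightarrow> complex)) \<Rightarrow> bool"
  where "canonical_map K T \<longleftrightarrow>
    (\<exists>\<tau> \<phi>. norm \<tau> = 1 \<and> \<phi> ` K = K \<and> (\<forall>s\<in>K. \<forall>t\<in>K. dist (\<phi> s) (\<phi> t) = dist s t) \<and>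
           (\<forall>f\<in>Lip K. \<forall>s\<in>K. T f s = \<tau> * f (\<phi> s)))"

definition Iso_Lip_canonical :: "'a::metric_space set \<Rightarrow> bool" where
  "Iso_Lip_canonical K \<longleftrightarrow> (\<forall>T\<in>Iso (Lip K) (lip_snorm K). canonical_map K T)"

end

theory Submission
  imports Defs
begin

text \<open>
  It suffices to find \<open>f \<in> Lip K\<close> with trivial stabiliser in the group of canonical isometries:
  every \<open>T\<^bsub>f,g\<^esub>\<close> sends \<open>f\<close> to \<open>\<Delta> f\<close>, so all of them agree on \<open>Lip K\<close>, and \<open>\<Delta>\<close> is one of them.
  Choose \<open>x\<^sub>n\<close> greedily among the points of \<open>K\<close> farthest from \<open>{x\<^sub>0, \<dots>, x\<^bsub>n-1\<^esub>}\<close>, and among these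
  minimising \<open>\<Sum>i<n. 3\<^bsup>-i\<^esup> d(\<cdot>, x\<^sub>i)\<close>, and put \<open>f = 1 + (\<Sum>i. 3\<^bsup>-i\<^esup> d(\<cdot>, x\<^sub>i))\<close>. Since
  \<open>3\<^bsup>-n\<^esup>\<close> exceeds the sum of all later weights, \<open>x\<^sub>n\<close> is the unique minimiser of \<open>f\<close> among the
  farthest points. Hence an isometry that preserves \<open>f\<close> fixes every \<open>x\<^sub>n\<close>, by induction, and so
  is the identity, as the \<open>x\<^sub>n\<close> are dense. Positivity of \<open>f\<close> takes care of the unimodular factor.
\<close>

section \<open>Greedy sequences of farthest points\<close>

definition farthest :: "'a::metric_space set \<Rightarrow> 'a set \<Rightarrow> 'a set" where
  "farthest K X = {z \<in> K. \<forall>y\<in>K. infdist y X \<le> infdist z X}"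

lemma compact_farthest: "compact K \<Longrightarrow> compact (farthest K X)"
proof -
  assume "compact K"
  have "farthest K X = K \<inter> (\<Inter>y\<in>K. {z. infdist y X \<le> infdist z X})"
    by (auto simp: farthest_def)
  moreover have "closed (\<Inter>y\<in>K. {z. infdist y X \<le> infdist z X})"
    by (intro closed_INT ballI closed_Collect_le continuous_intros)
  ultimately show ?thesis
    using \<open>compact K\<close> by (simp add: compact_Int_closed)
qed

lemma farthest_nonempty:
  assumes "compact K" "K \<noteq> {}"
  shows "farthest K X \<noteq> {}"
proof -
  have "continuous_on K (\<lambda>z. infdist z X)"
    by (intro continuous_intros)
  from continuous_attains_sup[OF assms this] show ?thesis
    by (auto simp: farthest_def)
qed

lemma infdist_cong:
  assumes "\<And>a. a \<in> X \<Longrightarrow> dist y a = dist z a"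
  shows "infdist y X = infdist z X"
proof -
  have "dist y ` X = dist z ` X"
    using assms by (rule image_cong[OF refl])
  then show ?thesis
    by (simp add: infdist_def)
qed

text \<open>Each choice minimises a continuous function over a nonempty compact set. At
  \<open>n = 0\<close> the distance to the empty set is 0 by convention and the sum is empty, so
  \<open>x 0\<close> may be any point of \<open>K\<close>.\<close>

lemma greedy_sequence_exists:
  fixes K :: "'a::metric_space set" and c :: "nat \<Rightarrow> real"
  assumes "compact K" "K \<noteq> {}"
  shows "\<exists>x. \<forall>n. x n \<in> farthest K (x ` {..<n}) \<and>
    (\<forall>y \<in> farthest K (x ` {..<n}).
       (\<Sum>i<n. c i * dist (x n) (x i)) \<le> (\<Sum>i<n. c i * dist y (x i)))"
proof -
  define P where "P x n r \<longleftrightarrow> r \<in> farthest K (x ` {..<n}) \<and>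
    (\<forall>y \<in> farthest K (x ` {..<n}).
       (\<Sum>i<n. c i * dist r (x i)) \<le> (\<Sum>i<n. c i * dist y (x i)))"
    for x :: "nat \<Rightarrow> 'a" and n :: nat and r
  have "\<exists>x. \<forall>n. P x n (x n)"
  \<comment> \<open>The condition on the \<open>n\<close>-th term reads only the terms below
    \<open>n\<close>, so the choices can be made by recursion.\<close>
  proof (rule dependent_wellorder_choice)
    fix r n and f g :: "nat \<Rightarrow> 'a"
    assume "\<And>i. i < n \<Longrightarrow> f i = g i"
    then have "f ` {..<n} = g ` {..<n}"
      and "\<And>y. (\<Sum>i<n. c i * dist y (f i)) = (\<Sum>i<n. c i * dist y (g i))"
      by (auto intro: image_cong sum.cong)
    then show "P f n r = P g n r"
      by (simp add: P_def)
  next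
    fix n and f :: "nat \<Rightarrow> 'a"
    have "continuous_on (farthest K (f ` {..<n})) (\<lambda>y. \<Sum>i<n. c i * dist y (f i))"
      by (intro continuous_intros)
    from continuous_attains_inf[OF compact_farthest farthest_nonempty this] assms
    show "\<exists>r. P f n r"
      by (auto simp: P_def)
  qed
  then show ?thesis
    by (simp add: P_def)
qed

text \<open>If \<open>z\<close> stayed \<open>e\<close> away from every term, then each term, being
  at least as far from its predecessors as \<open>z\<close> is, would be \<open>e\<close> away from
  them too. Compactness forbids such a separated sequence.\<close>

lemma greedy_sequence_dense:
  assumes "compact K" and x: "\<And>n::nat. x n \<in> farthest K (x ` {..<n})"
    and "z \<in> K" "0 < e"
  shows "\<exists>n. dist z (x n) < e"
proof (rule ccontr)
  assume "\<not> ?thesis"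
  then have far: "e \<le> dist z (x i)" for i
    by (simp add: not_less)
  have sep: "e \<le> dist (x n) (x i)" if "i < n" for i n
  proof -
    \<comment> \<open>Here \<open>i < n\<close> makes the set nonempty; the distance to the empty
      set would be 0.\<close>
    have "e \<le> infdist z (x ` {..<n})"
      using that far by (subst infdist_notempty) (auto intro!: cINF_greatest)
    also have "\<dots> \<le> infdist (x n) (x ` {..<n})"
      using x[of n] \<open>z \<in> K\<close> by (simp add: farthest_def)
    also have "\<dots> \<le> dist (x n) (x i)"
      using that by (intro infdist_le) simp
    finally show ?thesis .
  qed
  have "x n \<in> K" for n
    using x[of n] by (simp add: farthest_def)
  then obtain l r where r: "strict_mono (r :: nat \<Rightarrow> nat)" and "(x \<circ> r) \<longlonglongrightarrow> l"
    using \<open>compact K\<close> by (metis compact_def)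
  then have "Cauchy (x \<circ> r)"
    by (simp add: LIMSEQ_imp_Cauchy)
  then obtain M where "\<And>m n. m \<ge> M \<Longrightarrow> n \<ge> M \<Longrightarrow> dist (x (r m)) (x (r n)) < e"
    using \<open>0 < e\<close> by (metis Cauchy_def comp_apply)
  then have "dist (x (r (Suc M))) (x (r M)) < e"
    by simp
  with sep[of "r M" "r (Suc M)"] r show False
    by (simp add: strict_mono_Suc_iff)
qed

text \<open>The points \<open>z\<close> and \<open>\<psi> z\<close> are equally far from each
  \<open>x n\<close>, and by density this common distance can be made smaller than half of
  \<open>dist (\<psi> z) z\<close>, against the triangle inequality.\<close>

lemma isometry_fixing_greedy_sequence:
  assumes "compact K" and x: "\<And>n::nat. x n \<in> farthest K (x ` {..<n})"
    and iso: "\<And>s t. s \<in> K \<Longrightarrow> t \<in> K \<Longrightarrow> dist (\<psi> s) (\<psi> t) = dist s t"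
    and fixed: "\<And>n. \<psi> (x n) = x n" and "z \<in> K"
  shows "\<psi> z = z"
proof (rule ccontr)
  assume "\<psi> z \<noteq> z"
  then have "0 < dist (\<psi> z) z / 2"
    by simp
  then obtain n where n: "dist z (x n) < dist (\<psi> z) z / 2"
    using greedy_sequence_dense[OF assms(1) x \<open>z \<in> K\<close>] by blast
  have "dist (\<psi> z) (x n) = dist z (x n)"
    using iso[OF \<open>z \<in> K\<close>, of "x n"] x[of n] fixed[of n] by (simp add: farthest_def)
  with n show False
    using dist_triangle2[of "\<psi> z" z "x n"] by simp
qed

section \<open>A positive Lipschitz function without symmetries\<close>

text \<open>The triangle inequality, summed termwise. It serves twice: for the whole series it gives
  the Lipschitz constant, for a tail it bounds what the later weights can contribute.\<close>

lemma suminf_dist_diff_le: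
  fixes c :: "nat \<Rightarrow> real" and y z :: "'a::metric_space"
  assumes "\<And>n. 0 \<le> c n" "summable c"
    and "summable (\<lambda>n. c n * dist y (x n))" "summable (\<lambda>n. c n * dist z (x n))"
  shows "(\<Sum>n. c n * dist y (x n)) - (\<Sum>n. c n * dist z (x n)) \<le> suminf c * dist y z"
proof -
  have "(\<Sum>n. c n * dist y (x n)) - (\<Sum>n. c n * dist z (x n))
      = (\<Sum>n. c n * dist y (x n) - c n * dist z (x n))"
    using assms by (simp add: suminf_diff)
  also have "\<dots> \<le> (\<Sum>n. c n * dist y z)"
  proof (rule suminf_le)
    show "c n * dist y (x n) - c n * dist z (x n) \<le> c n * dist y z" for n
      using mult_left_mono[OF _ assms(1), of "dist y (x n) - dist z (x n)" "dist y z" n]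
        dist_triangle[of y "x n" z] by (simp add: algebra_simps)
  qed (use assms in \<open>auto intro: summable_diff summable_mult2\<close>)
  also have "\<dots> = suminf c * dist y z"
    using assms by (simp add: suminf_mult2)
  finally show ?thesis .
qed

text \<open>For compact \<open>K\<close> the isometric maps of \<open>K\<close> into itself form its
  isometry group, so this says that \<open>f\<close> has trivial stabiliser there.\<close>

definition asymmetric_on :: "'a::metric_space set \<Rightarrow> ('a \<Rightarrow> real) \<Rightarrow> bool" where
  "asymmetric_on K f \<longleftrightarrow>
    (\<forall>\<psi> \<in> K \<rightarrow> K. (\<forall>s\<in>K. \<forall>t\<in>K. dist (\<psi> s) (\<psi> t) = dist s t) \<longrightarrow>
      (\<forall>s\<in>K. f (\<psi> s) = f s) \<longrightarrow> (\<forall>s\<in>K. \<psi> s = s))"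

lemma asymmetric_onD:
  assumes "asymmetric_on K f" "\<psi> \<in> K \<rightarrow> K"
    and "\<And>s t. s \<in> K \<Longrightarrow> t \<in> K \<Longrightarrow> dist (\<psi> s) (\<psi> t) = dist s t"
    and "\<And>s. s \<in> K \<Longrightarrow> f (\<psi> s) = f s" and "s \<in> K"
  shows "\<psi> s = s"
  using bspec[OF assms(1)[unfolded asymmetric_on_def] assms(2)] assms(3-5) by simp

lemma asymmetric_lipschitz_function_exists:
  fixes K :: "'a::metric_space set"
  assumes "compact K"
  obtains f :: "'a \<Rightarrow> real" and C where "C-lipschitz_on K f" "\<forall>z\<in>K. 0 < f z"
    "asymmetric_on K f"
proof (cases "K = {}")
  case True
  then show thesis
    using that[of 0 "\<lambda>_. 1"] by (simp add: lipschitz_on_def asymmetric_on_def)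
next
  case False
  \<comment> \<open>With ratio 1/3 the weights after \<open>c k\<close> sum to
    \<open>c k / 2\<close>, strictly below \<open>c k\<close>; ratio 1/2 would give equality and
    lose uniqueness.\<close>
  define c :: "nat \<Rightarrow> real" where "c = (\<lambda>n. (1/3) ^ n)"
  obtain x where greedy: "\<forall>n. x n \<in> farthest K (x ` {..<n}) \<and>
      (\<forall>y \<in> farthest K (x ` {..<n}).
         (\<Sum>i<n. c i * dist (x n) (x i)) \<le> (\<Sum>i<n. c i * dist y (x i)))"
    by (rule exE[OF greedy_sequence_exists[OF assms False]])
  have x: "x n \<in> farthest K (x ` {..<n})" for n
    using greedy by simp
  have min: "(\<Sum>i<n. c i * dist (x n) (x i)) \<le> (\<Sum>i<n. c i * dist y (x i))"
    if "y \<in> farthest K (x ` {..<n})" for n y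
    using greedy that by simp
  have xK: "x n \<in> K" for n
    using x[of n] by (simp add: farthest_def)
  have c_nonneg: "0 \<le> c n" for n
    by (simp add: c_def)
  have c_sum: "summable (\<lambda>n. c (n + k))" for k
    by (simp add: c_def summable_geometric summable_ignore_initial_segment)
  have c_tail: "(\<Sum>n. c (n + Suc k)) = c k / 2" for k
  proof -
    have "(\<lambda>n. (1/3) ^ n * (1/3) ^ Suc k) sums (1 / (1 - 1/3) * (1/3) ^ Suc k :: real)"
      by (intro sums_mult2 geometric_sums) simp
    then show ?thesis
      by (simp add: c_def power_add sums_iff)
  qed
  have summ: "summable (\<lambda>n. c n * dist y (x n))" if "y \<in> K" for y
  proof (rule summable_comparison_test')
    show "summable (\<lambda>n. c n * diameter K)"
      using c_sum[of 0] by (simp add: summable_mult2)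
    show "norm (c n * dist y (x n)) \<le> c n * diameter K" for n
      using that xK assms c_nonneg
      by (simp add: abs_mult diameter_bounded_bound compact_imp_bounded mult_left_mono)
  qed
  have summ_shift: "summable (\<lambda>n. c (n + k) * dist y (x (n + k)))" if "y \<in> K" for y k
    using summable_ignore_initial_segment[OF summ[OF that]] .
  define f where "f y = 1 + (\<Sum>n. c n * dist y (x n))" for y
  have f_split: "f y = 1 + (\<Sum>n. c (n + Suc k) * dist y (x (n + Suc k)))
      + c k * dist y (x k) + (\<Sum>i<k. c i * dist y (x i))" if "y \<in> K" for y k
    using suminf_split_initial_segment[OF summ[OF that], of "Suc k"] by (simp add: f_def)
  have unique: "y = x n" if y: "y \<in> farthest K (x ` {..<n})" and "f y = f (x n)" for y n
  proof -
    have "y \<in> K"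
      using y by (simp add: farthest_def)
    \<comment> \<open>In \<open>f y = f (x n)\<close> the \<open>n\<close>-th term vanishes on the
      right, and the terms before it are smallest at \<open>x n\<close>. So the tails must make up
      for \<open>c n * dist y (x n)\<close>, but they supply at most half of it.\<close>
    have "(\<Sum>i. c (i + Suc n) * dist (x n) (x (i + Suc n)))
        - (\<Sum>i. c (i + Suc n) * dist y (x (i + Suc n))) \<le> c n / 2 * dist (x n) y"
      unfolding c_tail[symmetric]
      by (rule suminf_dist_diff_le) (intro c_nonneg c_sum summ_shift xK \<open>y \<in> K\<close>)+
    then have "c n / 2 * dist (x n) y \<le> 0"
      using f_split[OF \<open>y \<in> K\<close>, of n] f_split[OF xK, of n n] \<open>f y = f (x n)\<close> min[OF y]
      by (simp add: dist_commute)
    moreover have "0 < c n"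
      by (simp add: c_def)
    ultimately show ?thesis
      by (simp add: mult_le_0_iff)
  qed
  show thesis
  proof (rule that)
    show "(suminf c)-lipschitz_on K f"
    proof (rule lipschitz_onI)
      show "0 \<le> suminf c"
        using c_sum[of 0] c_nonneg by (simp add: suminf_nonneg)
      fix y z assume yz: "y \<in> K" "z \<in> K"
      have "f y - f z \<le> suminf c * dist y z" "f z - f y \<le> suminf c * dist z y"
        using suminf_dist_diff_le[of c y x z] suminf_dist_diff_le[of c z x y]
          yz summ c_nonneg c_sum[of 0] by (simp_all add: f_def)
      then show "dist (f y) (f z) \<le> suminf c * dist y z"
        by (simp add: dist_real_def dist_commute abs_le_iff)
    qed
    show "\<forall>z\<in>K. 0 < f z"
      using suminf_nonneg[OF summ] c_nonneg by (simp add: f_def add_pos_nonneg)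
    show "asymmetric_on K f"
      unfolding asymmetric_on_def
    proof (intro ballI impI)
      fix \<psi> z
      assume maps: "\<psi> \<in> K \<rightarrow> K" and "z \<in> K"
        and iso: "\<forall>s\<in>K. \<forall>t\<in>K. dist (\<psi> s) (\<psi> t) = dist s t"
        and inv: "\<forall>s\<in>K. f (\<psi> s) = f s"
      \<comment> \<open>Once the earlier points are fixed, \<open>\<psi> (x n)\<close> has the same
        distances to them as \<open>x n\<close>, hence is again a farthest point, with the same
        value of \<open>f\<close>.\<close>
      have "\<psi> (x n) = x n" for n
      proof (induction n rule: less_induct)
        case (less n)
        have "dist (\<psi> (x n)) (x i) = dist (x n) (x i)" if "i < n" for i
          using bspec[OF bspec[OF iso xK[of n]] xK[of i]] less[OF that] by simp
        then have "infdist (\<psi> (x n)) (x ` {..<n}) = infdist (x n) (x ` {..<n})"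
          by (intro infdist_cong) auto
        then have "\<psi> (x n) \<in> farthest K (x ` {..<n})"
          using x[of n] funcset_mem[OF maps xK[of n]] by (simp add: farthest_def)
        then show ?case
          using unique[of "\<psi> (x n)" n] inv xK by simp
      qed
      then show "\<psi> z = z"
        using iso
        by (intro isometry_fixing_greedy_sequence[OF assms x _ _ \<open>z \<in> K\<close>, where \<psi> = \<psi>]) blast+
    qed
  qed
qed

section \<open>From the rigid function to 2-local isometries\<close>

lemma canonical_isometry_separating_function_exists:
  fixes K :: "'a::metric_space set"
  assumes "compact K"
  shows "\<exists>f\<in>Lip K. \<forall>S T. canonical_map K S \<longrightarrow> canonical_map K T \<longrightarrow> S f = T f \<longrightarrow>
    (\<forall>g\<in>Lip K. \<forall>s\<in>K. S g s = T g s)"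
proof -
  obtain f :: "'a \<Rightarrow> real" and C where lip: "C-lipschitz_on K f"
    and "\<forall>z\<in>K. 0 < f z" and rigid: "asymmetric_on K f"
    using asymmetric_lipschitz_function_exists[OF assms] .
  then have pos: "0 < f z" if "z \<in> K" for z
    using that by blast
  define F where "F z = (if z \<in> K then complex_of_real (f z) else 0)" for z
  have lipF: "C-lipschitz_on K F"
    using lip by (auto simp: lipschitz_on_def F_def dist_norm simp flip: of_real_diff)
  then have "bounded (F ` K)"
    using assms compact_continuous_image compact_imp_bounded lipschitz_on_continuous_on by blast
  with lipF have "F \<in> Lip K"
    by (auto simp: Lip_def F_def)
  then show ?thesis
  proof (intro bexI allI impI ballI)
    fix S T g s
    assume canonical: "canonical_map K S" "canonical_map K T" and eq: "S F = T F"
      and g: "g \<in> Lip K" and "s \<in> K"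
    obtain \<sigma> \<phi> where S: "norm \<sigma> = 1" "\<phi> ` K = K"
        "\<And>s t. s \<in> K \<Longrightarrow> t \<in> K \<Longrightarrow> dist (\<phi> s) (\<phi> t) = dist s t"
        "\<And>f s. f \<in> Lip K \<Longrightarrow> s \<in> K \<Longrightarrow> S f s = \<sigma> * f (\<phi> s)"
      using canonical(1) unfolding canonical_map_def by blast
    obtain \<tau> \<theta> where T: "norm \<tau> = 1" "\<theta> ` K = K"
        "\<And>s t. s \<in> K \<Longrightarrow> t \<in> K \<Longrightarrow> dist (\<theta> s) (\<theta> t) = dist s t"
        "\<And>f s. f \<in> Lip K \<Longrightarrow> s \<in> K \<Longrightarrow> T f s = \<tau> * f (\<theta> s)"
      using canonical(2) unfolding canonical_map_def by blast
    have \<phi>K: "\<phi> s \<in> K" and \<theta>K: "\<theta> s \<in> K" if "s \<in> K" for s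
      using that S(2) T(2) by blast+
    have val: "\<sigma> * of_real (f (\<phi> s)) = \<tau> * of_real (f (\<theta> s))" if "s \<in> K" for s
      using S(4)[OF \<open>F \<in> Lip K\<close> that] T(4)[OF \<open>F \<in> Lip K\<close> that] eq \<phi>K[OF that] \<theta>K[OF that]
      by (simp add: F_def)
    \<comment> \<open>Norms remove the unimodular factors, and positivity lets the absolute values
      be dropped.\<close>
    have f_eq: "f (\<phi> s) = f (\<theta> s)" if "s \<in> K" for s
      using arg_cong[OF val[OF that], of norm] S(1) T(1) pos[OF \<phi>K[OF that]] pos[OF \<theta>K[OF that]]
      by (simp add: norm_mult)
    have "\<sigma> = \<tau>"
      using val[OF \<open>s \<in> K\<close>] f_eq[OF \<open>s \<in> K\<close>] pos[OF \<theta>K[OF \<open>s \<in> K\<close>]] by simp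
    \<comment> \<open>The isometry \<open>\<theta>\<close> after the inverse of
      \<open>\<phi>\<close> preserves \<open>f\<close>, so rigidity makes it the identity on
      \<open>K\<close>.\<close>
    define \<psi> where "\<psi> = \<theta> \<circ> inv_into K \<phi>"
    have inv: "inv_into K \<phi> t \<in> K" "\<phi> (inv_into K \<phi> t) = t" if "t \<in> K" for t
      using that S(2) by (auto simp: inv_into_into f_inv_into_f)
    have "inj_on \<phi> K"
      using S(3) by (metis dist_eq_0_iff inj_onI)
    have "\<psi> \<in> K \<rightarrow> K"
      using inv \<theta>K by (auto simp: \<psi>_def)
    moreover have "dist (\<psi> t) (\<psi> u) = dist t u" if "t \<in> K" "u \<in> K" for t u
      using T(3)[of "inv_into K \<phi> t" "inv_into K \<phi> u"] S(3)[of "inv_into K \<phi> t" "inv_into K \<phi> u"] inv that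
      by (simp add: \<psi>_def)
    moreover have "f (\<psi> t) = f t" if "t \<in> K" for t
      using f_eq[of "inv_into K \<phi> t"] inv that by (simp add: \<psi>_def)
    ultimately have "\<psi> (\<phi> s) = \<phi> s"
      using \<phi>K[OF \<open>s \<in> K\<close>] by (rule asymmetric_onD[OF rigid])
    then have "\<theta> s = \<phi> s"
      using \<open>inj_on \<phi> K\<close> \<open>s \<in> K\<close> by (simp add: \<psi>_def)
    with \<open>\<sigma> = \<tau>\<close> show "S g s = T g s"
      using S(4) T(4) g \<open>s \<in> K\<close> by simp
  qed
qed

theorem corollary3p7:
  fixes K :: "'a::metric_space set"
    and \<Delta> :: "('a \<Rightarrow> complex) \<Rightarrow> ('a \<Rightarrow> complex)"
  assumes "compact K"
    and "Iso_Lip_canonical K"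
    and "two_local_isometry (Lip K) (lip_snorm K) \<Delta>"
  shows "surjective_isometry (Lip K) (lip_snorm K) \<Delta>"
proof -
  obtain f where f: "f \<in> Lip K"
    and separates: "\<forall>S T. canonical_map K S \<longrightarrow> canonical_map K T \<longrightarrow> S f = T f \<longrightarrow>
      (\<forall>g\<in>Lip K. \<forall>s\<in>K. S g s = T g s)"
    by (rule bexE[OF canonical_isometry_separating_function_exists[OF assms(1)]])
  have local: "\<exists>T\<in>Iso (Lip K) (lip_snorm K). \<Delta> f = T f \<and> \<Delta> g = T g" if "g \<in> Lip K" for g
    using assms(3) f that by (simp add: two_local_isometry_def)
  have canonical: "canonical_map K T" if "T \<in> Iso (Lip K) (lip_snorm K)" for T
    using assms(2) that by (simp add: Iso_Lip_canonical_def)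
  obtain T where T: "T \<in> Iso (Lip K) (lip_snorm K)" "\<Delta> f = T f"
    using local[OF f] by blast
  then have surj: "surjective_isometry (Lip K) (lip_snorm K) T"
    by (simp add: Iso_def)
  \<comment> \<open>The isometry \<open>S\<close> provided for the pair \<open>f\<close>,
    \<open>g\<close> depends on \<open>g\<close>, but \<open>S f = \<Delta> f = T f\<close> forces
    it to agree with the fixed \<open>T\<close> on \<open>Lip K\<close>.\<close>
  have agree: "\<Delta> g = T g" if g: "g \<in> Lip K" for g
  proof
    fix s
    obtain S where S: "S \<in> Iso (Lip K) (lip_snorm K)" "\<Delta> f = S f" "\<Delta> g = S g"
      using local[OF g] by blast
    show "\<Delta> g s = T g s"
    proof (cases "s \<in> K")
      case True
      then show ?thesis
        using separates[rule_format, OF canonical[OF S(1)] canonical[OF T(1)] _ g] S T by simp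
    next
      case False
      \<comment> \<open>Canonicity says nothing outside \<open>K\<close>; there both functions are 0
        by the convention in \<open>Lip\<close>.\<close>
      have "\<Delta> g \<in> Lip K" "T g \<in> Lip K"
        using assms(3) surj g by (auto simp: two_local_isometry_def surjective_isometry_def)
      with False show ?thesis
        by (simp add: Lip_def)
    qed
  qed
  then have "\<Delta> ` Lip K = T ` Lip K"
    by (rule image_cong[OF refl])
  with agree surj show ?thesis
    by (simp add: surjective_isometry_def)
qed

end
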